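(* There is an absolute constant $c>0$ such that the following holds. Let $0<\alpha<1$, let $t\geq 10$, and let $G$ be a $(t,\alpha)$-expanding graph of order $n$. Then $G$ contains a minor with average degree at least $$c\,\alpha^3\,\frac{\sqrt{nt\log t}}{\sqrt{\log n}}.$$
   Context: All graphs are finite, simple. For $X\subseteq V(G)$, $N(X)=\{u\notin X: u \text{ has a neighbor in } X\}$ is the external neighborhood. A graph $G=(V,E)$ is $(t,\alpha)$-expanding if every subset $X\subset V$ with $|X|\le \alpha|V|/t$ satisfies $|N(X)|\ge t|X|$. A graph $\Gamma$ is a minor of $G$ if there are vertex-disjoint connected subgraphs $G_u\subseteq G$, one for each vertex $u$ of $\Gamma$, such that $G$ has an edge between $G_u$ and $G_{u'}$ whenever $uu'$ is an edge of $\Gamma$. Logarithms are natural; rounding is ignored.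
   Formalization: The formal theorem adds the hypothesis αn/t ≥ 1, since otherwise the expansion condition is vacuous and the edgeless graph is a counterexample; graphs are taken on natural-number vertices, which covers every finite graph up to isomorphism. *)

theory Defs
  imports Complex_Main "Graph_Theory.Digraph_Component"
begin

text \<open>
  A finite simple graph is a \<^locale>\<open>pair_graph\<close>: a finite loop-free symmetric digraph
  whose arcs are pairs of vertices.  An undirected edge is thus present as two arcs, and the degree
  of a vertex is its out-degree.
\<close>

definition ext_nbhd :: "'a pair_pre_digraph \<Rightarrow> 'a set \<Rightarrow> 'a set" where
  "ext_nbhd G X = {u \<in> pverts G. u \<notin> X \<and> (\<exists>x\<in>X. (u, x) \<in> parcs G)}"

definition expanding :: "real \<Rightarrow> real \<Rightarrow> 'a pair_pre_digraph \<Rightarrow> bool" where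
  "expanding t \<alpha> G \<longleftrightarrow>
     (\<forall>X \<subseteq> pverts G. real (card X) \<le> \<alpha> * real (card (pverts G)) / t \<longrightarrow>
        real (card (ext_nbhd G X)) \<ge> t * real (card X))"

text \<open>Connected graphs are nonempty in this library, so the branch sets below are nonempty.\<close>

definition minor_of :: "'b pair_pre_digraph \<Rightarrow> 'a pair_pre_digraph \<Rightarrow> bool" where
  "minor_of \<Gamma> G \<longleftrightarrow>
     (\<exists>H :: 'b \<Rightarrow> 'a pair_pre_digraph.
        (\<forall>u \<in> pverts \<Gamma>. pair_graph (H u) \<and> subgraph (with_proj (H u)) (with_proj G) \<and>
            Digraph_Component.connected (with_proj (H u))) \<and>
        (\<forall>u \<in> pverts \<Gamma>. \<forall>v \<in> pverts \<Gamma>. u \<noteq> v \<longrightarrow> pverts (H u) \<inter> pverts (H v) = {}) \<and>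
        (\<forall>(u, v) \<in> parcs \<Gamma>. \<exists>x \<in> pverts (H u). \<exists>y \<in> pverts (H v). (x, y) \<in> parcs G))"

definition average_degree :: "'a pair_pre_digraph \<Rightarrow> real" where
  "average_degree G =
     (\<Sum>v \<in> pverts G. real (out_degree (with_proj G) v)) / real (card (pverts G))"

end

theory Submission
  imports Defs
begin

text \<open>
  Write \<open>n\<close> for the order of \<open>G\<close> and \<open>L = ln n / ln t\<close>.  If \<open>n / t\<close> is at most of order
  \<open>L / \<alpha>\<^sup>2\<close>, then \<open>G\<close> itself, which has minimum degree at least \<open>t\<close>, is dense enough.  Otherwise,
  disjoint connected branch sets of size \<open>s\<close>, of order \<open>sqrt (L * n / t)\<close>, are chosen one after
  another until they cover \<open>\<alpha> * n / 10\<close> vertices.  After removing from the rest a small set of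
  vertices that expand badly, the remaining graph still expands by \<open>t / 2\<close>, so its balls of radius
  of order \<open>L\<close> have at least \<open>\<alpha> * n / 8\<close> vertices, and at most \<open>8 / \<alpha>\<close> clusters of such a
  radius cover it.  All but few earlier branch sets have at least \<open>t * s / 2\<close> neighbours in the
  remaining graph.  In a suitable cluster, about \<open>2 * n / (t * s)\<close> vertices, chosen greedily, meet
  the neighbourhoods of a proportion of order \<open>\<alpha>\<close> of them; joining these vertices to the centre of
  the cluster by short paths gives the next branch set.  The minor so obtained has average degree of
  order \<open>\<alpha>\<close> times the number of branch sets, which is \<open>\<alpha> * n / (10 * s)\<close>.
\<close>

section \<open>Connected vertex sets\<close>

text \<open>For symmetric \<open>E\<close> this is connectivity of the subgraph induced by
  \<open>S\<close>, nonempty as branch sets have to be. Vertex sets are used throughout; graphs are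
  built from them only when the minor is assembled.\<close>

definition connected_in :: "'a rel \<Rightarrow> 'a set \<Rightarrow> bool" where
  "connected_in E S \<longleftrightarrow> S \<noteq> {} \<and> (\<forall>x\<in>S. \<forall>y\<in>S. (x, y) \<in> (E \<inter> S \<times> S)\<^sup>*)"

lemma connected_in_singleton: "connected_in E {x}"
  by (auto simp: connected_in_def)

text \<open>Any two points of the union are joined through the common point
  \<open>c\<close>.\<close>

lemma connected_in_Union:
  assumes "\<And>S. S \<in> \<S> \<Longrightarrow> connected_in E S \<and> c \<in> S" and "\<S> \<noteq> {}"
  shows "connected_in E (\<Union>\<S>)"
proof -
  have sub: "(E \<inter> S \<times> S)\<^sup>* \<subseteq> (E \<inter> \<Union>\<S> \<times> \<Union>\<S>)\<^sup>*" if "S \<in> \<S>" for S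
    using that by (intro rtrancl_mono) auto
  have "(x, c) \<in> (E \<inter> \<Union>\<S> \<times> \<Union>\<S>)\<^sup>*" "(c, x) \<in> (E \<inter> \<Union>\<S> \<times> \<Union>\<S>)\<^sup>*" if "x \<in> \<Union>\<S>" for x
    using that assms(1) sub unfolding connected_in_def by blast+
  then have "(x, y) \<in> (E \<inter> \<Union>\<S> \<times> \<Union>\<S>)\<^sup>*" if "x \<in> \<Union>\<S>" "y \<in> \<Union>\<S>" for x y
    using that by (meson rtrancl_trans)
  moreover have "\<Union>\<S> \<noteq> {}" using assms by blast
  ultimately show ?thesis unfolding connected_in_def by blast
qed

lemma connected_in_Un:
  assumes "connected_in E S" "connected_in E T" "c \<in> S" "c \<in> T"
  shows "connected_in E (S \<union> T)"
  using connected_in_Union[of "{S, T}" E c] assms by auto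

lemma connected_in_insert:
  assumes "connected_in E S" "sym E" "x \<in> S" "(x, y) \<in> E"
  shows "connected_in E (insert y S)"
proof -
  have yx: "(y, x) \<in> E" using assms(2,4) by (rule symD)
  have "connected_in E {x, y}"
    using assms(4) yx unfolding connected_in_def by (auto intro: r_into_rtrancl)
  from connected_in_Un[OF assms(1) this, of x] assms(3) show ?thesis
    by (simp add: insert_absorb)
qed

lemma connected_in_boundary_edge:
  assumes "connected_in E T" "K \<subset> T" "K \<noteq> {}"
  obtains x y where "x \<in> K" "y \<in> T - K" "(x, y) \<in> E"
proof -
  obtain a b where ab: "a \<in> K" "b \<in> T - K" using assms by blast
  then have "(a, b) \<in> (E \<inter> T \<times> T)\<^sup>*"
    using assms unfolding connected_in_def by blast
  then have "b \<in> K \<or> (\<exists>x\<in>K. \<exists>y\<in>T - K. (x, y) \<in> E)"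
    by (induction rule: rtrancl_induct) (use ab in auto)
  then show ?thesis using ab that by blast
qed

text \<open>As long as the set is proper in \<open>T\<close>, some arc leaves it inside
  \<open>T\<close>, and the endpoint of that arc can be added. This pads a branch set to exactly
  \<open>s\<close> vertices.\<close>

lemma connected_in_extend:
  assumes "sym E" "finite T" "connected_in E T" "connected_in E K" "K \<subseteq> T"
    and "card K \<le> s" "s \<le> card T"
  shows "\<exists>B. K \<subseteq> B \<and> B \<subseteq> T \<and> connected_in E B \<and> card B = s"
  using assms(6,7)
proof (induction s rule: dec_induct)
  case base
  then show ?case using assms by auto
next
  case (step m)
  then obtain B where B: "K \<subseteq> B" "B \<subseteq> T" "connected_in E B" "card B = m"
    by auto
  then have "B \<subset> T" "B \<noteq> {}" using step by (auto simp: connected_in_def)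
  then obtain x y where xy: "x \<in> B" "y \<in> T - B" "(x, y) \<in> E"
    using connected_in_boundary_edge[OF assms(3)] by metis
  have "card (insert y B) = Suc m"
    using B xy finite_subset[OF B(2) assms(2)] by simp
  moreover have "connected_in E (insert y B)"
    using B xy assms(1) by (blast intro: connected_in_insert)
  ultimately show ?case using B xy by (intro exI[of _ "insert y B"]) auto
qed

section \<open>Hitting sets\<close>

lemma sum_le_imp_ex_le:
  fixes x y :: "'i \<Rightarrow> real"
  assumes "finite T" "T \<noteq> {}" "sum x T \<le> sum y T"
  shows "\<exists>a\<in>T. x a \<le> y a"
  using assms sum_strict_mono[of T y x] by (meson not_le)

text \<open>Greedy derandomisation: averaging over \<open>C\<close>, some point meets a proportion \<open>\<rho>\<close> of the
  sets not yet hit.\<close>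

lemma greedy_hitting_set:
  fixes F :: "'i \<Rightarrow> 'a set" and \<rho> :: real
  assumes "finite I" "finite C" "C \<noteq> {}" "\<rho> \<le> 1"
    and F: "\<And>i. i \<in> I \<Longrightarrow> F i \<subseteq> C \<and> \<rho> * real (card C) \<le> real (card (F i))"
  shows "\<exists>R \<subseteq> C. card R \<le> l \<and> real (card {i\<in>I. F i \<inter> R = {}}) \<le> (1 - \<rho>) ^ l * real (card I)"
proof (induction l)
  case 0
  have "card {i\<in>I. F i \<inter> {} = {}} = card I" by simp
  then show ?case by (intro exI[of _ "{}"]) auto
next
  case (Suc l)
  then obtain R where R: "R \<subseteq> C" "card R \<le> l"
    "real (card {i\<in>I. F i \<inter> R = {}}) \<le> (1 - \<rho>) ^ l * real (card I)" by blast
  define J where "J = {i\<in>I. F i \<inter> R = {}}"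
  have finJ: "finite J" using assms by (simp add: J_def)
  have "\<exists>w\<in>C. \<rho> * real (card J) \<le> real (card {i\<in>J. w \<in> F i})"
  proof (rule sum_le_imp_ex_le[OF assms(2,3)])
    have "(\<Sum>w\<in>C. \<rho> * real (card J)) = (\<Sum>i\<in>J. \<rho> * real (card C))" by simp
    also have "\<dots> \<le> (\<Sum>i\<in>J. real (card (F i)))"
      using F by (intro sum_mono) (auto simp: J_def)
    also have "\<dots> = (\<Sum>i\<in>J. \<Sum>w\<in>C. if w \<in> F i then 1 else 0)"
    proof (rule sum.cong)
      fix i assume "i \<in> J"
      then have "F i = {w\<in>C. w \<in> F i}" using F by (auto simp: J_def)
      then have "card (F i) = card {w\<in>C. w \<in> F i}" by simp
      then show "real (card (F i)) = (\<Sum>w\<in>C. if w \<in> F i then 1 else 0)"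
        using assms(2) by (simp add: sum.inter_filter[symmetric])
    qed simp
    also have "\<dots> = (\<Sum>w\<in>C. \<Sum>i\<in>J. if w \<in> F i then 1 else 0)" by (rule sum.swap)
    also have "\<dots> = (\<Sum>w\<in>C. real (card {i\<in>J. w \<in> F i}))"
      using finJ by (simp add: sum.inter_filter[symmetric])
    finally show "(\<Sum>w\<in>C. \<rho> * real (card J)) \<le> (\<Sum>w\<in>C. real (card {i\<in>J. w \<in> F i}))" .
  qed
  then obtain w where w: "w \<in> C" "\<rho> * real (card J) \<le> real (card {i\<in>J. w \<in> F i})" by blast
  have "{i\<in>I. F i \<inter> insert w R = {}} = J - {i\<in>J. w \<in> F i}" by (auto simp: J_def)
  then have "real (card {i\<in>I. F i \<inter> insert w R = {}}) = real (card J) - real (card {i\<in>J. w \<in> F i})"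
    using finJ by (simp add: card_Diff_subset of_nat_diff card_mono)
  also have "\<dots> \<le> (1 - \<rho>) * real (card J)" using w by (simp add: algebra_simps)
  also have "\<dots> \<le> (1 - \<rho>) * ((1 - \<rho>) ^ l * real (card I))"
    using R(3) assms(4) by (intro mult_left_mono) (auto simp: J_def)
  finally have "real (card {i\<in>I. F i \<inter> insert w R = {}}) \<le> (1 - \<rho>) ^ Suc l * real (card I)"
    by (simp add: mult_ac)
  moreover have "card (insert w R) \<le> Suc l"
    using R card_insert_le_m1[of "Suc l" R w] by simp
  ultimately show ?case using R w by (intro exI[of _ "insert w R"]) auto
qed

text \<open>After \<open>l\<close> greedy choices the missed proportion is at most (1 - \<rho>)^l
  \<le> exp (- \<rho> l) \<le> exp (-1) \<le> 1/2.\<close>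

corollary half_hitting_set:
  fixes F :: "'i \<Rightarrow> 'a set" and \<rho> :: real
  assumes "finite I" "finite C" "C \<noteq> {}" "0 < \<rho>" "\<rho> \<le> 1" "1 / \<rho> \<le> real l"
    and F: "\<And>i. i \<in> I \<Longrightarrow> F i \<subseteq> C \<and> \<rho> * real (card C) \<le> real (card (F i))"
  obtains R where "R \<subseteq> C" "card R \<le> l" "real (card I) / 2 \<le> real (card {i\<in>I. F i \<inter> R \<noteq> {}})"
proof -
  obtain R where R: "R \<subseteq> C" "card R \<le> l"
    "real (card {i\<in>I. F i \<inter> R = {}}) \<le> (1 - \<rho>) ^ l * real (card I)"
    using greedy_hitting_set[where l = l and F = F, OF assms(1,2,3,5) F] by auto
  have "(1 - \<rho>) ^ l \<le> exp (- \<rho>) ^ l"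
    using exp_ge_add_one_self[of "- \<rho>"] assms by (intro power_mono) auto
  also have "\<dots> = exp (- (\<rho> * real l))" by (simp add: exp_of_nat_mult[symmetric] mult_ac)
  also have "\<dots> \<le> exp (- 1)" using assms by (simp add: field_simps)
  also have "\<dots> \<le> 1 / 2" using exp_ge_add_one_self[of 1] by (simp add: exp_minus field_simps)
  finally have "(1 - \<rho>) ^ l * real (card I) \<le> 1 / 2 * real (card I)"
    by (intro mult_right_mono) auto
  moreover have "card I = card {i\<in>I. F i \<inter> R = {}} + card {i\<in>I. F i \<inter> R \<noteq> {}}"
    using assms(1) by (subst card_Un_disjoint[symmetric]) (auto intro: arg_cong[where f = card])
  ultimately show ?thesis using R by (intro that[of R]) auto
qed

section \<open>Balls\<close>

text \<open>For symmetric \<open>E\<close> this is the ball of radius \<open>r\<close> in the graph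
  induced by \<open>W\<close>: a path of length at most \<open>r\<close> has at most
  \<open>r + 1\<close> vertices. A connected set replaces the path because such sets are later glued
  together into a branch set.\<close>

definition ball_in :: "'a rel \<Rightarrow> 'a set \<Rightarrow> nat \<Rightarrow> 'a \<Rightarrow> 'a set" where
  "ball_in E W r v =
     {w. \<exists>P \<subseteq> W. finite P \<and> connected_in E P \<and> v \<in> P \<and> w \<in> P \<and> card P \<le> Suc r}"

lemma ball_in_subset: "ball_in E W r v \<subseteq> W"
  by (auto simp: ball_in_def)

lemma center_in_ball_in: "v \<in> W \<Longrightarrow> v \<in> ball_in E W r v"
  unfolding ball_in_def by (auto intro!: exI[of _ "{v}"] connected_in_singleton)

lemma ball_in_commute: "w \<in> ball_in E W r v \<longleftrightarrow> v \<in> ball_in E W r w"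
  by (auto simp: ball_in_def)

lemma ball_in_mono: "r \<le> r' \<Longrightarrow> ball_in E W r v \<subseteq> ball_in E W r' v"
  unfolding ball_in_def by (blast intro: le_trans Suc_le_mono[THEN iffD2])

lemma ball_in_trans:
  assumes "u \<in> ball_in E W a v" "w \<in> ball_in E W b u"
  shows "w \<in> ball_in E W (a + b) v"
proof -
  obtain P where P: "P \<subseteq> W" "finite P" "connected_in E P" "v \<in> P" "u \<in> P" "card P \<le> Suc a"
    using assms(1) by (auto simp: ball_in_def)
  obtain R where R: "R \<subseteq> W" "finite R" "connected_in E R" "u \<in> R" "w \<in> R" "card R \<le> Suc b"
    using assms(2) by (auto simp: ball_in_def)
  \<comment> \<open>The shared vertex \<open>u\<close> is counted twice; this saves the one vertex
    needed for radii to add up exactly.\<close>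
  have "card (P \<union> R) + card (P \<inter> R) = card P + card R"
    using card_Un_Int[OF P(2) R(2)] by simp
  moreover have "card (P \<inter> R) \<ge> 1"
    using P R by (simp add: Suc_le_eq card_gt_0_iff) blast
  ultimately have "card (P \<union> R) \<le> Suc (a + b)" using P R by linarith
  moreover have "connected_in E (P \<union> R)" using P R by (blast intro: connected_in_Un)
  ultimately show ?thesis
    using P R unfolding ball_in_def by (intro CollectI exI[of _ "P \<union> R"]) auto
qed

lemma ball_in_step:
  assumes "sym E" "w \<in> ball_in E W r v" "(w, y) \<in> E" "y \<in> W"
  shows "y \<in> ball_in E W (Suc r) v"
proof -
  obtain P where P: "P \<subseteq> W" "finite P" "connected_in E P" "v \<in> P" "w \<in> P" "card P \<le> Suc r"
    using assms(2) by (auto simp: ball_in_def)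
  have "connected_in E (insert y P)" using P assms by (blast intro: connected_in_insert)
  moreover have "card (insert y P) \<le> Suc (Suc r)"
    using P card_insert_le_m1[of "Suc (Suc r)" P y] by simp
  ultimately show ?thesis
    using P assms(4) unfolding ball_in_def by (intro CollectI exI[of _ "insert y P"]) auto
qed

lemma connected_in_ball_in:
  assumes "v \<in> W"
  shows "connected_in E (ball_in E W r v)"
proof -
  let ?S = "{P. P \<subseteq> W \<and> finite P \<and> connected_in E P \<and> v \<in> P \<and> card P \<le> Suc r}"
  have "ball_in E W r v = \<Union>?S" by (auto simp: ball_in_def)
  moreover have "{v} \<in> ?S" using assms by (auto intro: connected_in_singleton)
  then have "connected_in E (\<Union>?S)" by (intro connected_in_Union[of _ _ v]) auto
  ultimately show ?thesis by simp
qed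

text \<open>Take a maximal set \<open>D\<close> of centres with disjoint balls of radius
  \<open>r\<close>. By maximality the ball around any \<open>w\<close> meets one of these, which
  puts \<open>w\<close> within \<open>2 * r\<close> of its centre; disjointness inside
  \<open>W\<close> bounds the number of centres.\<close>

lemma ball_in_clustering:
  fixes \<beta> :: real
  assumes "finite W" "0 < \<beta>" and large: "\<And>v. v \<in> W \<Longrightarrow> \<beta> \<le> real (card (ball_in E W r v))"
  obtains f where "\<And>w. w \<in> W \<Longrightarrow> f w \<in> W \<and> w \<in> ball_in E W (2 * r) (f w)"
    and "real (card (f ` W)) * \<beta> \<le> real (card W)"
proof -
  let ?b = "ball_in E W r"
  define \<D> where "\<D> = {D. D \<subseteq> W \<and> disjoint_family_on ?b D}"
  have "finite \<D>" using assms(1) by (simp add: \<D>_def)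
  moreover have "{} \<in> \<D>" by (simp add: \<D>_def disjoint_family_on_def)
  ultimately obtain D where D: "D \<in> \<D>" "\<And>D'. D' \<in> \<D> \<Longrightarrow> D \<subseteq> D' \<Longrightarrow> D = D'"
    using finite_has_maximal[of \<D>] by blast
  have DW: "D \<subseteq> W" "finite D" using D assms(1) by (auto simp: \<D>_def intro: finite_subset)
  have near: "\<exists>a\<in>D. ?b a \<inter> ?b w \<noteq> {}" if "w \<in> W" for w
  proof (cases "w \<in> D")
    case True
    then show ?thesis using center_in_ball_in[OF that] by blast
  next
    case False
    then have "insert w D \<notin> \<D>" using D(2)[of "insert w D"] by blast
    then show ?thesis
      using D(1) that False by (auto simp: \<D>_def disjoint_family_on_def)
  qed
  then obtain f where f: "\<And>w. w \<in> W \<Longrightarrow> f w \<in> D \<and> ?b (f w) \<inter> ?b w \<noteq> {}" by metis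
  show ?thesis
  proof
    fix w assume w: "w \<in> W"
    then obtain u where "u \<in> ?b (f w)" "u \<in> ?b w" using f by blast
    then have "w \<in> ball_in E W (r + r) (f w)"
      using ball_in_commute by (metis ball_in_trans)
    then show "f w \<in> W \<and> w \<in> ball_in E W (2 * r) (f w)"
      using f[OF w] DW by (auto simp: mult_2)
  next
    have "real (card (f ` W)) * \<beta> \<le> real (card D) * \<beta>"
      using f DW assms(2) by (intro mult_right_mono) (auto intro: card_mono)
    also have "\<dots> = (\<Sum>a\<in>D. \<beta>)" by simp
    also have "\<dots> \<le> (\<Sum>a\<in>D. real (card (?b a)))" using DW large by (intro sum_mono) auto
    also have "\<dots> = real (card (\<Union>a\<in>D. ?b a))"
      using D(1) DW assms(1)
      by (subst card_UN_disjoint) (auto simp: \<D>_def disjoint_family_on_def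
          intro: finite_subset[OF ball_in_subset])
    also have "\<dots> \<le> real (card W)"
      using assms(1) ball_in_subset[of E W r] by (intro of_nat_mono card_mono) auto
    finally show "real (card (f ` W)) * \<beta> \<le> real (card W)" .
  qed
qed

section \<open>Expansion outside the branch sets\<close>

context pair_graph
begin

lemma sym_parcs: "sym (parcs G)"
  using arcs_symmetric by (auto intro: symI)

lemma finite_ext_nbhd: "finite (ext_nbhd G X)"
  using pair_finite_verts by (simp add: ext_nbhd_def)

lemma expanding_remainder:
  fixes t \<alpha> :: real
  assumes exp: "expanding t \<alpha> G" and t: "0 < t"
    and U: "U \<subseteq> pverts G" "real (card U) \<le> \<alpha> * real (card (pverts G)) / 4"
  obtains A where "A \<subseteq> pverts G - U" "t * real (card A) \<le> 2 * real (card U)"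
    and "\<And>X. X \<subseteq> pverts G - U - A \<Longrightarrow> real (card X) \<le> \<alpha> * real (card (pverts G)) / (2 * t) \<Longrightarrow>
           t / 2 * real (card X) \<le> real (card (ext_nbhd G X \<inter> (pverts G - U - A)))"
proof -
  let ?Q = "\<alpha> * real (card (pverts G)) / t"
  \<comment> \<open>Remove a maximal set that expands badly outside \<open>U\<close>: it has many neighbours in \<open>U\<close>, hence
    is small, and a badly expanding set in the remainder could be added to it.\<close>
  define \<A> where "\<A> = {A. A \<subseteq> pverts G - U \<and> real (card A) \<le> ?Q \<and>
    real (card (ext_nbhd G A - U)) \<le> t / 2 * real (card A)}"
  have "finite \<A>" using pair_finite_verts by (simp add: \<A>_def)
  \<comment> \<open>The empty set qualifies because \<open>?Q\<close> is nonnegative, which the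
    bound \<open>U(2)\<close> on a cardinality forces.\<close>
  moreover have "{} \<in> \<A>"
    using order_trans[OF of_nat_0_le_iff U(2)] t by (simp add: \<A>_def ext_nbhd_def)
  ultimately obtain A where A: "A \<in> \<A>" "\<And>B. B \<in> \<A> \<Longrightarrow> A \<subseteq> B \<Longrightarrow> A = B"
    using finite_has_maximal[of \<A>] by blast
  have finU: "finite U" and finA: "finite A"
    using A U pair_finite_verts by (auto simp: \<A>_def intro: finite_subset)
  have "t * real (card A) \<le> real (card (ext_nbhd G A))"
    using A(1) exp by (auto simp: \<A>_def expanding_def)
  also have "\<dots> \<le> real (card (ext_nbhd G A - U) + card U)"
    using finite_ext_nbhd[of A] finU
    by (intro of_nat_mono order_trans[OF card_mono card_Un_le]) auto
  finally have tA: "t * real (card A) \<le> 2 * real (card U)"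
    using A(1) by (simp add: \<A>_def)
  \<comment> \<open>The constant 4 in the bound on \<open>U\<close> serves here: \<open>A\<close>
    and a set \<open>X\<close> as in the conclusion each use at most half of \<open>?Q\<close>, so
    their union is still small enough to belong to \<open>\<A>\<close>.\<close>
  then have QA: "real (card A) \<le> ?Q / 2" using U(2) t by (simp add: field_simps)
  show ?thesis
  proof (rule that)
    show "A \<subseteq> pverts G - U" using A(1) by (simp add: \<A>_def)
    show "t * real (card A) \<le> 2 * real (card U)" by (rule tA)
    fix X assume X: "X \<subseteq> pverts G - U - A" "real (card X) \<le> \<alpha> * real (card (pverts G)) / (2 * t)"
    have finX: "finite X" using X pair_finite_verts by (auto intro: finite_subset)
    show "t / 2 * real (card X) \<le> real (card (ext_nbhd G X \<inter> (pverts G - U - A)))"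
    proof (rule ccontr)
      assume less: "\<not> ?thesis"
      then have "X \<noteq> {}" by auto
      have cAX: "card (A \<union> X) = card A + card X"
        using X finA finX by (intro card_Un_disjoint) auto
      have "ext_nbhd G (A \<union> X) - U \<subseteq>
          (ext_nbhd G A - U) \<union> (ext_nbhd G X \<inter> (pverts G - U - A))"
        by (auto simp: ext_nbhd_def)
      then have "card (ext_nbhd G (A \<union> X) - U) \<le>
          card (ext_nbhd G A - U) + card (ext_nbhd G X \<inter> (pverts G - U - A))"
        using finite_ext_nbhd by (intro order_trans[OF card_mono card_Un_le]) auto
      then have "real (card (ext_nbhd G (A \<union> X) - U)) \<le>
          real (card (ext_nbhd G A - U)) + real (card (ext_nbhd G X \<inter> (pverts G - U - A)))"
        by linarith
      also have "\<dots> \<le> t / 2 * real (card (A \<union> X))"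
        using A(1) less by (simp add: \<A>_def cAX algebra_simps)
      finally have "A \<union> X \<in> \<A>"
        using A(1) X QA by (auto simp: \<A>_def cAX)
      then show False using A(2)[of "A \<union> X"] X \<open>X \<noteq> {}\<close> by blast
    qed
  qed
qed

text \<open>While a ball has at most \<open>q\<close> vertices, the next one is larger by a factor
  \<open>\<tau>\<close>, so radius \<open>k\<close> suffices to reach size \<open>q\<close>. Since
  only sets of size at most \<open>q\<close> are known to expand, the last step expands a subset of
  the ball.\<close>

lemma card_ball_in_ge:
  fixes \<tau> q :: real
  assumes W: "W \<subseteq> pverts G" and "1 \<le> q" "0 \<le> \<tau>" "q < \<tau> ^ k" "v \<in> W"
    and exp: "\<And>X. X \<subseteq> W \<Longrightarrow> real (card X) \<le> q \<Longrightarrow> \<tau> * real (card X) \<le> real (card (ext_nbhd G X \<inter> W))"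
  shows "\<tau> * q / 2 \<le> real (card (ball_in (parcs G) W (Suc k) v))"
proof -
  let ?b = "\<lambda>r. ball_in (parcs G) W r v"
  have fin: "finite (?b r)" for r
    using ball_in_subset W pair_finite_verts by (metis finite_subset)
  have step: "ext_nbhd G X \<inter> W \<subseteq> ?b (Suc r)" if "X \<subseteq> ?b r" for X r
    using that ball_in_step[OF sym_parcs] sym_parcs by (fastforce simp: ext_nbhd_def dest: symD)
  have grow: "q < real (card (?b r)) \<or> \<tau> ^ r \<le> real (card (?b r))" for r
  proof (induction r)
    case 0
    have "v \<in> ?b 0" using \<open>v \<in> W\<close> by (rule center_in_ball_in)
    then have "1 \<le> card (?b 0)" using fin by (simp add: Suc_le_eq card_gt_0_iff) blast
    then show ?case by simp
  next
    case (Suc r)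
    show ?case
    proof (cases "real (card (?b r)) \<le> q")
      case True
      have "\<tau> ^ Suc r \<le> \<tau> * real (card (?b r))"
        using Suc True assms by (auto intro: mult_left_mono)
      also have "\<dots> \<le> real (card (ext_nbhd G (?b r) \<inter> W))"
        using True by (intro exp ball_in_subset)
      also have "\<dots> \<le> real (card (?b (Suc r)))"
        using step fin by (intro of_nat_mono card_mono) auto
      finally show ?thesis by simp
    next
      case False
      have "card (?b r) \<le> card (?b (Suc r))"
        using fin by (intro card_mono ball_in_mono) auto
      then show ?thesis using False by linarith
    qed
  qed
  have "nat \<lfloor>q\<rfloor> \<le> card (?b k)" using grow[of k] assms by linarith
  then obtain X where X: "X \<subseteq> ?b k" "card X = nat \<lfloor>q\<rfloor>" by (metis obtain_subset_with_card_n)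
  \<comment> \<open>For \<open>q\<close> at least 1, rounding down loses at most half.\<close>
  have "1 \<le> \<lfloor>q\<rfloor>" using assms(2) by simp
  then have cX: "real (card X) \<le> q" "q / 2 \<le> real (card X)" unfolding X(2) by linarith+
  have "\<tau> * q / 2 \<le> \<tau> * real (card X)" using mult_left_mono[OF cX(2) assms(3)] by simp
  also have "\<dots> \<le> real (card (ext_nbhd G X \<inter> W))"
    using cX order_trans[OF X(1) ball_in_subset] by (intro exp)
  also have "\<dots> \<le> real (card (?b (Suc k)))"
    using step X fin by (intro of_nat_mono card_mono) auto
  finally show ?thesis .
qed

text \<open>A union of branch sets expands as well; if all of them had few neighbours in the remainder,
  the neighbourhood of the union would not fit into the small set \<open>U \<union> A\<close>.\<close>

lemma few_poorly_attached:
  fixes t \<alpha> :: real and B :: "nat \<Rightarrow> 'a set"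
  assumes exp: "expanding t \<alpha> G" and t: "10 \<le> t"
    and B: "\<And>i. i < m \<Longrightarrow> B i \<subseteq> pverts G \<and> card (B i) = s" "disjoint_family_on B {..<m}"
    and U: "U = (\<Union>i<m. B i)" "real m * real s \<le> \<alpha> * real (card (pverts G)) / 10"
    and A: "finite A" "t * real (card A) \<le> 2 * real (card U)"
    and s: "0 < s" "real s \<le> \<alpha> * real (card (pverts G)) / (2 * t)"
  shows "real (card {i. i < m \<and> real (card (ext_nbhd G (B i) \<inter> (pverts G - U - A))) < t * real s / 2})
           \<le> 6 / 25 * \<alpha> * real (card (pverts G)) / (t * real s)"
proof -
  let ?V = "pverts G" and ?Q = "\<alpha> * real (card (pverts G)) / t"
  let ?W = "?V - U - A"
  define bad where "bad = {i. i < m \<and> real (card (ext_nbhd G (B i) \<inter> ?W)) < t * real s / 2}"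
  have finB: "finite (B i)" if "i < m" for i
    using B that pair_finite_verts by (metis finite_subset)
  have finU: "finite U" using finB by (simp add: U)
  have cardUN: "card (\<Union>i\<in>J. B i) = card J * s" if "J \<subseteq> {..<m}" for J
  proof -
    have "card (\<Union>i\<in>J. B i) = (\<Sum>i\<in>J. card (B i))"
      using that B(2) finB finite_subset[OF that]
      by (intro card_UN_disjoint) (auto simp: disjoint_family_on_def subset_iff)
    also have "\<dots> = (\<Sum>i\<in>J. s)" using that B(1) by (intro sum.cong) auto
    finally show ?thesis by simp
  qed
  have cU: "real (card U) \<le> \<alpha> * real (card ?V) / 10"
    using cardUN[of "{..<m}"] U by simp
  have cA: "real (card A) \<le> real (card U) / 5"
  proof -
    have "10 * real (card A) \<le> t * real (card A)" using t by (intro mult_right_mono) auto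
    then show ?thesis using A(2) by simp
  qed
  \<comment> \<open>With \<open>Z\<close> the union over \<open>J\<close>, t |Z| \<le> |N(Z)| \<le>
    t |Z| / 2 + |U| + |A|, so t |Z| is at most twice (1 + 1/5) \<alpha> n / 10, which is 6/25
    \<alpha> n.\<close>
  have key: "real (card J) * real s \<le> 6 / 25 * ?Q" if J: "J \<subseteq> bad" "real (card J) * real s \<le> ?Q" for J
  proof -
    define Z where "Z = (\<Union>i\<in>J. B i)"
    have Jm: "J \<subseteq> {..<m}" "finite J" using J by (auto simp: bad_def intro: finite_subset)
    have cZ: "real (card Z) = real (card J) * real s" using cardUN[OF Jm(1)] by (simp add: Z_def)
    have "t * real (card Z) \<le> real (card (ext_nbhd G Z))"
    proof -
      have "Z \<subseteq> ?V" using Jm B(1) by (auto simp: Z_def)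
      then show ?thesis using exp J(2) unfolding expanding_def cZ[symmetric] by blast
    qed
    also have "card (ext_nbhd G Z) \<le> card ((\<Union>i\<in>J. ext_nbhd G (B i) \<inter> ?W) \<union> (U \<union> A))"
      using Jm finU A(1) finite_ext_nbhd
      by (intro card_mono) (auto simp: Z_def ext_nbhd_def)
    also have "\<dots> \<le> card (\<Union>i\<in>J. ext_nbhd G (B i) \<inter> ?W) + (card U + card A)"
      by (meson add_left_mono card_Un_le order_trans)
    also have "\<dots> \<le> (\<Sum>i\<in>J. card (ext_nbhd G (B i) \<inter> ?W)) + (card U + card A)"
      by (intro add_right_mono card_UN_le Jm)
    finally have "t * real (card Z) \<le>
        (\<Sum>i\<in>J. real (card (ext_nbhd G (B i) \<inter> ?W))) + real (card U) + real (card A)"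
      by simp
    also have "(\<Sum>i\<in>J. real (card (ext_nbhd G (B i) \<inter> ?W))) \<le> (\<Sum>i\<in>J. t * real s / 2)"
      using J by (intro sum_mono) (auto simp: bad_def)
    also have "\<dots> = t * real (card Z) / 2" by (simp add: cZ)
    finally have "t * real (card Z) \<le> 6 / 25 * (\<alpha> * real (card ?V))"
      using cA cU by simp
    then show ?thesis using t by (simp add: cZ field_simps)
  qed
  \<comment> \<open>\<open>key\<close> speaks only of families small enough to expand. If
    \<open>bad\<close> were larger, a subfamily of floor (\<open>?Q / s\<close>) sets would have
    total size above \<open>?Q / 2\<close>, contradicting \<open>key\<close>.\<close>
  have "real (card bad) * real s \<le> ?Q"
  proof (rule ccontr)
    assume big: "\<not> ?thesis"
    have sQ: "2 * real s \<le> ?Q" using s(2) t by (simp add: field_simps)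
    define x where "x = ?Q / real s"
    have Qx: "?Q = x * real s" using s(1) by (simp add: x_def)
    have x: "2 \<le> x" using sQ s(1) unfolding Qx by simp
    define j where "j = nat \<lfloor>x\<rfloor>"
    have j: "real j \<le> x" "x / 2 < real j" using x unfolding j_def by linarith+
    then have js: "real j * real s \<le> ?Q" "?Q / 2 < real j * real s"
      unfolding Qx using s(1) by auto
    then have "real j * real s < real (card bad) * real s" using big by linarith
    then have "real j < real (card bad)" by (rule mult_right_less_imp_less) simp
    then have "j \<le> card bad" by simp
    then obtain J where "J \<subseteq> bad" "card J = j" by (metis obtain_subset_with_card_n)
    then have "?Q / 2 < 6 / 25 * ?Q" using key[of J] js by simp
    moreover have "0 < ?Q" using sQ s(1) by linarith
    ultimately show False by simp
  qed
  then have "real (card bad) * real s \<le> 6 / 25 * ?Q" by (intro key) auto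
  then have "real (card bad) \<le> 6 / 25 * \<alpha> * real (card ?V) / (t * real s)"
    using s(1) t by (simp add: field_simps)
  then show ?thesis by (simp add: bad_def)
qed

end

section \<open>Choosing the branch sets\<close>

lemma sum_card_fibres:
  assumes "finite S" "finite T" "f ` S \<subseteq> T"
  shows "(\<Sum>a\<in>T. real (card {x\<in>S. f x = a})) = real (card S)"
  using sum.group[OF assms, of "\<lambda>_. 1 :: real"] by simp

context pair_graph
begin

text \<open>The factor \<open>\<alpha> / 16\<close> combines the choice of the best of at most 8 /
  \<alpha> clusters with the half lost to the hitting set; the subtracted term accounts for the
  poorly attached sets. The lower bound on \<open>s\<close> leaves room for a centre and
  \<open>l\<close> paths of \<open>2 * Suc k\<close> further vertices each.\<close>

lemma next_branch_set:
  fixes t \<alpha> :: real and B :: "nat \<Rightarrow> 'a set"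
  assumes exp: "expanding t \<alpha> G" and t: "10 \<le> t" and \<alpha>: "0 < \<alpha>" "\<alpha> < 1"
    and n: "n = card (pverts G)" "2 * t \<le> \<alpha> * real n"
    and B: "\<And>i. i < m \<Longrightarrow> B i \<subseteq> pverts G \<and> card (B i) = s" "disjoint_family_on B {..<m}"
    and m: "real m * real s \<le> \<alpha> * real n / 10"
    and s: "real s \<le> \<alpha> * real n / (2 * t)" "1 + 2 * Suc k * l \<le> s"
    and k: "real n \<le> (t / 2) ^ k" and l: "2 * real n / (t * real s) \<le> real l"
  shows "\<exists>B'. B' \<subseteq> pverts G - (\<Union>i<m. B i) \<and> connected_in (parcs G) B' \<and> card B' = s \<and>
    \<alpha> / 16 * (real m - 6 / 25 * \<alpha> * real n / (t * real s))
      \<le> real (card {i. i < m \<and> (\<exists>x\<in>B'. \<exists>y\<in>B i. (x, y) \<in> parcs G)})"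
proof -
  let ?V = "pverts G" and ?E = "parcs G"
  have s0: "0 < s" using s(2) by simp
  have "0 < \<alpha> * real n" using n(2) t by linarith
  then have n0: "0 < real n" using \<alpha>(1) by (simp add: zero_less_mult_iff)
  define U where "U = (\<Union>i<m. B i)"
  have UV: "U \<subseteq> ?V" using B(1) by (auto simp: U_def)
  have finU: "finite U" using UV pair_finite_verts by (rule finite_subset)
  have "card U \<le> (\<Sum>i<m. card (B i))" unfolding U_def by (intro card_UN_le) simp
  also have "\<dots> = m * s" using B(1) by simp
  finally have "real (card U) \<le> real m * real s" by (metis of_nat_le_iff of_nat_mult)
  then have cU: "real (card U) \<le> \<alpha> * real n / 10" using m by linarith
  obtain A where A: "A \<subseteq> ?V - U" "t * real (card A) \<le> 2 * real (card U)"
    and expW: "\<And>X. X \<subseteq> ?V - U - A \<Longrightarrow> real (card X) \<le> \<alpha> * real (card ?V) / (2 * t) \<Longrightarrow>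
           t / 2 * real (card X) \<le> real (card (ext_nbhd G X \<inter> (?V - U - A)))"
    using expanding_remainder[OF exp _ UV] cU t n(1) \<alpha>(1) by auto
  define W where "W = ?V - U - A"
  have WV: "W \<subseteq> ?V" and finW: "finite W" and finA: "finite A"
    using pair_finite_verts A(1) by (auto simp: W_def intro: finite_subset)
  have cW: "real (card W) \<le> real n" using WV pair_finite_verts by (simp add: n(1) card_mono)
  have "W \<noteq> {}"
  proof
    assume "W = {}"
    then have "card ?V \<le> card (U \<union> A)" using finU finA by (intro card_mono) (auto simp: W_def)
    also have "\<dots> \<le> card U + card A" by (rule card_Un_le)
    finally have "real n \<le> real (card U) + real (card A)" using n(1) by linarith
    moreover have "10 * real (card A) \<le> t * real (card A)" using t by (intro mult_right_mono) auto
    moreover have "\<alpha> * real n < real n" using \<alpha> n0 by simp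
    ultimately show False using A(2) cU n0 by linarith
  qed

  \<comment> \<open>\<open>G\<close> restricted to \<open>W\<close> may be disconnected, so the new branch set is built inside one of
    at most \<open>8 / \<alpha>\<close> clusters, each of radius \<open>2 * r\<close> around its centre.\<close>
  define r where "r = Suc k"
  \<comment> \<open>This is the bound \<open>\<tau> * q / 2\<close> of
    \<open>card_ball_in_ge\<close> for \<tau> = t / 2 and q = \<alpha> n / (2 t).\<close>
  define \<beta> where "\<beta> = \<alpha> * real n / 8"
  have large: "\<beta> \<le> real (card (ball_in ?E W r v))" if "v \<in> W" for v
  proof -
    have "\<alpha> * real n / (2 * t) < real n"
    proof -
      have "\<alpha> * real n < 1 * real n" using \<alpha> n0 by (intro mult_strict_right_mono) auto
      moreover have "1 * real n \<le> (2 * t) * real n" using t by (intro mult_right_mono) auto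
      ultimately show ?thesis using t by (simp add: field_simps)
    qed
    then have "\<alpha> * real n / (2 * t) < (t / 2) ^ k" using k by linarith
    moreover have "1 \<le> \<alpha> * real n / (2 * t)" using n(2) t by (simp add: field_simps)
    ultimately have "t / 2 * (\<alpha> * real n / (2 * t)) / 2 \<le> real (card (ball_in ?E W (Suc k) v))"
      using that t expW unfolding W_def[symmetric] n(1)[symmetric]
      by (intro card_ball_in_ge[OF WV]) auto
    then show ?thesis using t by (simp add: \<beta>_def r_def)
  qed
  have \<beta>0: "0 < \<beta>" using \<alpha> n0 by (simp add: \<beta>_def)
  obtain f where f: "\<And>w. w \<in> W \<Longrightarrow> f w \<in> W \<and> w \<in> ball_in ?E W (2 * r) (f w)"
    and p: "real (card (f ` W)) * \<beta> \<le> real (card W)"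
    using ball_in_clustering[OF finW \<beta>0 large] by auto
  define C where "C a = {w\<in>W. f w = a}" for a
  have finC: "finite (C a)" for a using finW by (simp add: C_def)
  have fW: "finite (f ` W)" "f ` W \<noteq> {}" using finW \<open>W \<noteq> {}\<close> by auto
  have p8: "real (card (f ` W)) \<le> 8 / \<alpha>"
  proof -
    have "real (card (f ` W)) * \<beta> \<le> real n" using p cW by linarith
    then show ?thesis using \<alpha> n0 by (simp add: \<beta>_def field_simps)
  qed

  \<comment> \<open>A well attached set has at least t s / 2 neighbours in \<open>W\<close>, and
    \<open>W\<close> has at most \<open>n\<close> vertices, so these neighbours fill at least a
    proportion \<open>\<rho>\<close> of \<open>W\<close>.\<close>
  define \<rho> where "\<rho> = t * real s / (2 * real n)"
  have \<rho>: "0 < \<rho>" "\<rho> \<le> 1" "1 / \<rho> \<le> real l"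
  proof -
    show "0 < \<rho>" using t s0 n0 by (simp add: \<rho>_def)
    have "t * real s \<le> \<alpha> * real n / 2" using s(1) t by (simp add: field_simps)
    moreover have "\<alpha> * real n < real n" using \<alpha> n0 by simp
    ultimately have "t * real s \<le> 2 * real n" using n0 by linarith
    then show "\<rho> \<le> 1" using n0 by (simp add: \<rho>_def)
    show "1 / \<rho> \<le> real l" using l by (simp add: \<rho>_def)
  qed
  define N where "N i = ext_nbhd G (B i)" for i
  define good where "good = {i. i < m \<and> t * real s / 2 \<le> real (card (N i \<inter> W))}"
  have fing: "finite good" by (simp add: good_def)
  \<comment> \<open>The clusters partition \<open>W\<close>, so a set filling a proportion
    \<open>\<rho>\<close> of \<open>W\<close> fills that proportion of some cluster.\<close>
  have "\<exists>a\<in>f ` W. \<rho> * real (card (C a)) \<le> real (card (N i \<inter> C a))" if "i \<in> good" for i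
  proof (rule sum_le_imp_ex_le[OF fW])
    have "(\<Sum>a\<in>f ` W. \<rho> * real (card (C a))) = \<rho> * real (card W)"
      unfolding C_def sum_distrib_left[symmetric] using finW fW by (simp add: sum_card_fibres)
    also have "\<dots> \<le> \<rho> * real n" using cW \<rho>(1) by simp
    also have "\<dots> = t * real s / 2" using n0 by (simp add: \<rho>_def)
    also have "\<dots> \<le> real (card (N i \<inter> W))" using that by (simp add: good_def)
    also have "\<dots> = (\<Sum>a\<in>f ` W. real (card {w\<in>N i \<inter> W. f w = a}))"
      using finW fW by (intro sum_card_fibres[symmetric]) auto
    also have "\<dots> = (\<Sum>a\<in>f ` W. real (card (N i \<inter> C a)))"
      by (intro sum.cong arg_cong[where f = "\<lambda>S. real (card S)"]) (auto simp: C_def)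
    finally show "(\<Sum>a\<in>f ` W. \<rho> * real (card (C a))) \<le> (\<Sum>a\<in>f ` W. real (card (N i \<inter> C a)))" .
  qed
  then obtain g where g: "\<And>i. i \<in> good \<Longrightarrow> g i \<in> f ` W \<and>
      \<rho> * real (card (C (g i))) \<le> real (card (N i \<inter> C (g i)))"
    by metis
  \<comment> \<open>Pigeonhole: some cluster is selected by at least the average number of good
    sets. All further work takes place around its centre \<open>a\<close>.\<close>
  have "\<exists>a\<in>f ` W. real (card good) / real (card (f ` W)) \<le> real (card {i\<in>good. g i = a})"
    using fW fing g by (intro sum_le_imp_ex_le) (auto simp: sum_card_fibres image_subset_iff)
  then obtain a where a: "a \<in> f ` W"
    and many: "real (card good) / real (card (f ` W)) \<le> real (card {i\<in>good. g i = a})" by blast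
  define I where "I = {i\<in>good. g i = a}"
  have aW: "a \<in> W" using a f by auto
  have Ca: "C a \<noteq> {}" using a by (auto simp: C_def)
  have finI: "finite I" using fing by (simp add: I_def)
  have FI: "N i \<inter> C a \<subseteq> C a \<and> \<rho> * real (card (C a)) \<le> real (card (N i \<inter> C a))" if "i \<in> I" for i
    using g that by (auto simp: I_def)
  obtain R where R: "R \<subseteq> C a" "card R \<le> l"
    "real (card I) / 2 \<le> real (card {i\<in>I. (N i \<inter> C a) \<inter> R \<noteq> {}})"
    by (rule half_hitting_set[where F = "\<lambda>i. N i \<inter> C a", OF finI finC Ca \<rho> FI])
  have finR: "finite R" using R(1) finC by (rule finite_subset)

  have "\<exists>P \<subseteq> W. finite P \<and> connected_in ?E P \<and> a \<in> P \<and> w \<in> P \<and> card P \<le> Suc (2 * r)"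
    if "w \<in> R" for w
    using f[of w] that R(1) by (auto simp: C_def ball_in_def)
  then obtain P where P: "\<And>w. w \<in> R \<Longrightarrow> P w \<subseteq> W \<and> finite (P w) \<and> connected_in ?E (P w) \<and>
      a \<in> P w \<and> w \<in> P w \<and> card (P w) \<le> Suc (2 * r)"
    by metis
  define K where "K = insert a (\<Union>w\<in>R. P w)"
  have K: "K \<subseteq> W" "a \<in> K" "R \<subseteq> K" using P aW by (auto simp: K_def)
  have connK: "connected_in ?E K"
  proof -
    have "connected_in ?E (\<Union>(insert {a} (P ` R)))"
      using P by (intro connected_in_Union[of _ _ a]) (auto intro: connected_in_singleton)
    then show ?thesis by (simp add: K_def)
  qed
  have "card K \<le> s"
  proof -
    \<comment> \<open>Every \<open>P w\<close> contains \<open>a\<close>. Counting \<open>a\<close>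
      once, each path costs \<open>2 * r\<close> vertices instead of
      \<open>2 * r + 1\<close>.\<close>
    have K': "K = insert a (\<Union>w\<in>R. P w - {a})" by (auto simp: K_def)
    have "card K \<le> Suc (card (\<Union>w\<in>R. P w - {a}))"
      unfolding K' by (rule card_insert_le_m1) auto
    also have "\<dots> \<le> Suc (\<Sum>w\<in>R. card (P w - {a}))"
      by (intro Suc_le_mono[THEN iffD2] card_UN_le finR)
    also have "\<dots> \<le> Suc (\<Sum>w\<in>R. 2 * r)"
      using P by (intro Suc_leI le_imp_less_Suc sum_mono) (fastforce simp: card_Diff_singleton)
    also have "\<dots> = 1 + 2 * Suc k * card R" by (simp add: r_def)
    also have "\<dots> \<le> 1 + 2 * Suc k * l" using R(2) by (intro add_left_mono mult_le_mono2)
    finally show ?thesis using s(2) by simp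
  qed
  \<comment> \<open>The ball around \<open>a\<close> is connected, lies in \<open>W\<close> and has
    at least \<beta> \<ge> s vertices, so it supplies the padding for \<open>K\<close>.\<close>
  let ?T = "K \<union> ball_in ?E W r a"
  have TW: "?T \<subseteq> W" using K(1) by (simp add: ball_in_subset)
  have "s \<le> card ?T"
  proof -
    have "\<alpha> * real n / (2 * t) \<le> \<beta>"
      unfolding \<beta>_def using t \<alpha> n0 by (intro divide_left_mono) auto
    then have "real s \<le> real (card (ball_in ?E W r a))" using s(1) large[OF aW] by linarith
    also have "\<dots> \<le> real (card ?T)"
      using finite_subset[OF TW finW] by (intro of_nat_mono card_mono) auto
    finally show ?thesis by simp
  qed
  moreover have "connected_in ?E ?T"
    using connK connected_in_ball_in[OF aW] K(2) center_in_ball_in[OF aW] by (rule connected_in_Un)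
  ultimately obtain B' where B': "K \<subseteq> B'" "B' \<subseteq> ?T" "connected_in ?E B'" "card B' = s"
    using connected_in_extend[OF sym_parcs finite_subset[OF TW finW] _ connK _ \<open>card K \<le> s\<close>] by auto
  let ?adj = "{i. i < m \<and> (\<exists>x\<in>B'. \<exists>y\<in>B i. (x, y) \<in> ?E)}"
  have "{i\<in>I. (N i \<inter> C a) \<inter> R \<noteq> {}} \<subseteq> ?adj"
    using B'(1) K(3) by (fastforce simp: I_def good_def N_def ext_nbhd_def)
  then have "card {i\<in>I. (N i \<inter> C a) \<inter> R \<noteq> {}} \<le> card ?adj" by (intro card_mono) auto
  then have "real (card I) / 2 \<le> real (card ?adj)" using R(3) by linarith
  moreover have "\<alpha> / 8 * real (card good) \<le> real (card I)"
  proof -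
    have p0: "0 < real (card (f ` W))" using fW by (simp add: card_gt_0_iff)
    have "\<alpha> / 8 * real (card good) \<le> 1 / real (card (f ` W)) * real (card good)"
      using p8 p0 \<alpha> by (intro mult_right_mono) (auto simp: field_simps)
    also have "\<dots> \<le> real (card I)" using many by (simp add: I_def)
    finally show ?thesis .
  qed
  moreover have "real m - 6 / 25 * \<alpha> * real n / (t * real s) \<le> real (card good)"
  proof -
    let ?bad = "{i. i < m \<and> real (card (ext_nbhd G (B i) \<inter> (?V - U - A))) < t * real s / 2}"
    have "real (card ?bad) \<le> 6 / 25 * \<alpha> * real n / (t * real s)"
      using few_poorly_attached[OF exp t B U_def _ finA A(2) s0] m s(1) by (simp add: n(1))
    moreover have "card {..<m} \<le> card (good \<union> ?bad)"
      using fing by (intro card_mono) (auto simp: good_def N_def W_def not_le)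
    then have "m \<le> card good + card ?bad" using card_Un_le[of good ?bad] by simp
    ultimately show ?thesis by linarith
  qed
  then have "\<alpha> / 16 * (real m - 6 / 25 * \<alpha> * real n / (t * real s)) \<le> \<alpha> / 16 * real (card good)"
    using \<alpha> by (intro mult_left_mono) auto
  ultimately have "\<alpha> / 16 * (real m - 6 / 25 * \<alpha> * real n / (t * real s)) \<le> real (card ?adj)"
    by linarith
  moreover have "B' \<subseteq> ?V - (\<Union>i<m. B i)" using B'(2) TW by (auto simp: W_def U_def)
  ultimately show ?thesis using B' by blast
qed

text \<open>Iterates \<open>next_branch_set\<close>. Adjacency is counted towards earlier sets only,
  so appending a set leaves the previous bounds intact.\<close>

lemma branch_sets_exist:
  fixes t \<alpha> :: real
  assumes exp: "expanding t \<alpha> G" and t: "10 \<le> t" and \<alpha>: "0 < \<alpha>" "\<alpha> < 1"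
    and n: "n = card (pverts G)" "2 * t \<le> \<alpha> * real n"
    and s: "real s \<le> \<alpha> * real n / (2 * t)" "1 + 2 * Suc k * l \<le> s"
    and k: "real n \<le> (t / 2) ^ k" and l: "2 * real n / (t * real s) \<le> real l"
    and m: "real m * real s \<le> \<alpha> * real n / 10"
  shows "\<exists>B. (\<forall>i<m. B i \<subseteq> pverts G \<and> connected_in (parcs G) (B i) \<and> card (B i) = s \<and>
      \<alpha> / 16 * (real i - 6 / 25 * \<alpha> * real n / (t * real s))
        \<le> real (card {j. j < i \<and> (\<exists>x\<in>B i. \<exists>y\<in>B j. (x, y) \<in> parcs G)})) \<and>
    disjoint_family_on B {..<m}"
  using m
proof (induction m)
  case 0
  then show ?case by (simp add: disjoint_family_on_def)
next
  case (Suc m)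
  have m: "real m * real s \<le> \<alpha> * real n / 10"
    using Suc.prems by (simp add: distrib_right)
  let ?adj = "\<lambda>B i. {j. j < i \<and> (\<exists>x\<in>B i. \<exists>y\<in>B j. (x, y) \<in> parcs G)}"
  obtain B where B: "\<And>i. i < m \<Longrightarrow> B i \<subseteq> pverts G \<and> connected_in (parcs G) (B i) \<and> card (B i) = s \<and>
      \<alpha> / 16 * (real i - 6 / 25 * \<alpha> * real n / (t * real s)) \<le> real (card (?adj B i))"
    and disj: "disjoint_family_on B {..<m}"
    using Suc.IH[OF m] by auto
  have "B i \<subseteq> pverts G \<and> card (B i) = s" if "i < m" for i using B[OF that] by simp
  from next_branch_set[OF exp t \<alpha> n this disj m s k l]
  obtain B' where B': "B' \<subseteq> pverts G - (\<Union>i<m. B i)" "connected_in (parcs G) B'" "card B' = s"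
    "\<alpha> / 16 * (real m - 6 / 25 * \<alpha> * real n / (t * real s))
      \<le> real (card {i. i < m \<and> (\<exists>x\<in>B'. \<exists>y\<in>B i. (x, y) \<in> parcs G)})"
    by auto
  define D where "D = B(m := B')"
  have adj: "?adj D i = (if i = m then {i. i < m \<and> (\<exists>x\<in>B'. \<exists>y\<in>B i. (x, y) \<in> parcs G)} else ?adj B i)"
    if "i < Suc m" for i
    using that by (auto simp: D_def)
  have "D i \<subseteq> pverts G \<and> connected_in (parcs G) (D i) \<and> card (D i) = s \<and>
      \<alpha> / 16 * (real i - 6 / 25 * \<alpha> * real n / (t * real s)) \<le> real (card (?adj D i))"
    if i: "i < Suc m" for i
  proof (cases "i = m")
    case True
    then show ?thesis using B' unfolding adj[OF i] by (auto simp: D_def)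
  next
    case False
    then show ?thesis using B[of i] i unfolding adj[OF i] by (auto simp: D_def)
  qed
  moreover have "disjoint_family_on D {..<Suc m}"
    unfolding disjoint_family_on_def
  proof (intro ballI impI)
    fix i j assume ij: "i \<in> {..<Suc m}" "j \<in> {..<Suc m}" "i \<noteq> j"
    show "D i \<inter> D j = {}"
    proof (cases "i = m \<or> j = m")
      case True
      then show ?thesis using ij B'(1) by (auto simp: D_def)
    next
      case False
      then show ?thesis using ij disj by (auto simp: D_def disjoint_family_on_def)
    qed
  qed
  ultimately show ?case by blast
qed

end

section \<open>The resulting minor\<close>

lemma (in pair_fin_digraph) average_degree_eq:
  "average_degree G = real (card (parcs G)) / real (card (pverts G))"
proof -
  have "(\<Sum>v\<in>pverts G. out_degree (with_proj G) v) = (\<Sum>v\<in>pverts G. card {e\<in>parcs G. fst e = v})"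
    by (simp add: out_degree_def out_arcs_def)
  also have "\<dots> = card (parcs G)"
    using sum.group[OF pair_finite_arcs pair_finite_verts, of fst "\<lambda>_. 1 :: nat"] arc_fst_in_verts
    by (simp add: image_subset_iff)
  finally show ?thesis unfolding average_degree_def by (metis of_nat_sum)
qed

context pair_graph
begin

text \<open>Bridge to the library: its connectivity refers to the symmetric closure of a graph, and
  the induced subgraph \<open>H\<close> is already symmetric.\<close>

lemma connected_in_imp_connected_subgraph:
  assumes "S \<subseteq> pverts G" "connected_in (parcs G) S"
  defines "H \<equiv> \<lparr>pverts = S, parcs = parcs G \<inter> S \<times> S\<rparr>"
  shows "pair_graph H" "subgraph (with_proj H) (with_proj G)"
    "Digraph_Component.connected (with_proj H)"
proof -
  have "finite S" using assms(1) pair_finite_verts by (rule finite_subset)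
  moreover have symH: "symmetric (with_proj H)"
    using sym_arcs unfolding symmetric_def H_def by (auto simp: sym_def)
  ultimately show gH: "pair_graph H"
    using pair_no_loops pair_finite_arcs by unfold_locales (auto simp: H_def)
  then interpret H: pair_graph H .
  show "subgraph (with_proj H) (with_proj G)"
    using assms(1) H.wf_digraph_axioms wf_digraph_axioms
    by (auto simp: subgraph_def H_def compatible_def)
  show "Digraph_Component.connected (with_proj H)"
    using assms(2) unfolding Digraph_Component.connected_def strongly_connected_def
    by (auto simp: H.reachable_mk_symmetric_eq[OF symH] H.reachable_conv connected_in_def)
       (auto simp: H_def)
qed

text \<open>The last fact keeps only arcs from a later to an earlier branch set, because the greedy
  choice controls exactly these.\<close>

lemma minor_of_branch_sets:
  fixes B :: "nat \<Rightarrow> 'a set"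
  assumes B: "\<And>i. i < M \<Longrightarrow> B i \<subseteq> pverts G \<and> connected_in (parcs G) (B i)"
    and disj: "disjoint_family_on B {..<M}"
  defines "\<Gamma> \<equiv> \<lparr>pverts = {..<M},
    parcs = {(i, j). i < M \<and> j < M \<and> i \<noteq> j \<and> (\<exists>x\<in>B i. \<exists>y\<in>B j. (x, y) \<in> parcs G)}\<rparr>"
  shows "pair_graph \<Gamma>" "minor_of \<Gamma> G"
    "(\<Sum>i<M. card {j. j < i \<and> (\<exists>x\<in>B i. \<exists>y\<in>B j. (x, y) \<in> parcs G)}) \<le> card (parcs \<Gamma>)"
proof -
  have fin: "finite (parcs \<Gamma>)"
    by (rule finite_subset[of _ "{..<M} \<times> {..<M}"]) (auto simp: \<Gamma>_def)
  have "symmetric (with_proj \<Gamma>)"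
    using arcs_symmetric by (fastforce simp: symmetric_def \<Gamma>_def sym_def)
  then show "pair_graph \<Gamma>"
    using fin by unfold_locales (auto simp: \<Gamma>_def)
  show "minor_of \<Gamma> G"
    unfolding minor_of_def
  proof (intro exI[of _ "\<lambda>i. \<lparr>pverts = B i, parcs = parcs G \<inter> B i \<times> B i\<rparr>"] conjI ballI impI)
    fix i assume "i \<in> pverts \<Gamma>"
    then have "B i \<subseteq> pverts G" "connected_in (parcs G) (B i)" using B by (auto simp: \<Gamma>_def)
    from connected_in_imp_connected_subgraph[OF this]
    show "pair_graph \<lparr>pverts = B i, parcs = parcs G \<inter> B i \<times> B i\<rparr>"
      "subgraph (with_proj \<lparr>pverts = B i, parcs = parcs G \<inter> B i \<times> B i\<rparr>) (with_proj G)"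
      "Digraph_Component.connected (with_proj \<lparr>pverts = B i, parcs = parcs G \<inter> B i \<times> B i\<rparr>)" .
  qed (use disj in \<open>auto simp: \<Gamma>_def disjoint_family_on_def\<close>)
  let ?J = "\<lambda>i. {j. j < i \<and> (\<exists>x\<in>B i. \<exists>y\<in>B j. (x, y) \<in> parcs G)}"
  have "(\<Sum>i<M. card (?J i)) = card (SIGMA i:{..<M}. ?J i)" by simp
  also have "\<dots> \<le> card (parcs \<Gamma>)" using fin by (intro card_mono) (auto simp: \<Gamma>_def)
  finally show "(\<Sum>i<M. card (?J i)) \<le> card (parcs \<Gamma>)" .
qed

text \<open>Singletons serve as branch sets; this covers the case where \<open>G\<close> itself is
  dense enough.\<close>

lemma minor_of_refl: "minor_of G G"
  unfolding minor_of_def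
proof (intro exI[of _ "\<lambda>v. \<lparr>pverts = {v}, parcs = parcs G \<inter> {v} \<times> {v}\<rparr>"] conjI ballI impI)
  fix v assume "v \<in> pverts G"
  then have "{v} \<subseteq> pverts G" by simp
  from connected_in_imp_connected_subgraph[OF this connected_in_singleton]
  show "pair_graph \<lparr>pverts = {v}, parcs = parcs G \<inter> {v} \<times> {v}\<rparr>"
    "subgraph (with_proj \<lparr>pverts = {v}, parcs = parcs G \<inter> {v} \<times> {v}\<rparr>) (with_proj G)"
    "Digraph_Component.connected (with_proj \<lparr>pverts = {v}, parcs = parcs G \<inter> {v} \<times> {v}\<rparr>)" .
qed auto

text \<open>Expansion of singletons, which the second assumption makes small enough, gives every
  vertex degree at least \<open>t\<close>.\<close>

lemma expanding_average_degree_ge: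
  assumes "expanding t \<alpha> G" "1 \<le> \<alpha> * real (card (pverts G)) / t" "pverts G \<noteq> {}"
  shows "t \<le> average_degree G"
proof -
  have "t \<le> real (out_degree (with_proj G) v)" if v: "v \<in> pverts G" for v
  proof -
    have "{v} \<subseteq> pverts G" "real (card {v}) \<le> \<alpha> * real (card (pverts G)) / t"
      using v assms(2) by auto
    then have "t * real (card {v}) \<le> real (card (ext_nbhd G {v}))"
      using assms(1) unfolding expanding_def by blast
    also have "card (ext_nbhd G {v}) \<le> card (snd ` out_arcs (with_proj G) v)"
    proof (intro card_mono finite_imageI finite_out_arcs subsetI)
      fix u assume "u \<in> ext_nbhd G {v}"
      then have "(v, u) \<in> parcs G" using sym_parcs by (auto simp: ext_nbhd_def dest: symD)
      then show "u \<in> snd ` out_arcs (with_proj G) v" by (intro image_eqI[of _ _ "(v, u)"]) auto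
    qed
    also have "\<dots> \<le> out_degree (with_proj G) v"
      unfolding out_degree_def by (intro card_image_le finite_out_arcs)
    finally show ?thesis by simp
  qed
  then have "(\<Sum>v\<in>pverts G. t) \<le> (\<Sum>v\<in>pverts G. real (out_degree (with_proj G) v))"
    by (intro sum_mono)
  then show ?thesis
    using assms(3) pair_finite_verts by (simp add: average_degree_def field_simps card_gt_0_iff)
qed

text \<open>Summing \<alpha> (i - b) / 16 over i < M gives a number of arcs quadratic in
  \<open>M\<close>, since \<open>b\<close> is only a fraction of \<open>M\<close>; dividing by the
  \<open>M\<close> vertices leaves a linear bound.\<close>

lemma expanding_minor_of_parameters:
  fixes t \<alpha> :: real
  assumes exp: "expanding t \<alpha> G" and t: "10 \<le> t" and \<alpha>: "0 < \<alpha>" "\<alpha> < 1"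
    and n: "n = card (pverts G)" "2 * t \<le> \<alpha> * real n"
    and s: "real s \<le> \<alpha> * real n / (2 * t)" "1 + 2 * Suc k * l \<le> s"
    and k: "real n \<le> (t / 2) ^ k" and l: "2 * real n / (t * real s) \<le> real l"
    and M: "5 \<le> M" "real M * real s \<le> \<alpha> * real n / 10" "\<alpha> * real n / 10 \<le> (real M + 1) * real s"
  obtains \<Gamma> :: "nat pair_pre_digraph"
  where "pair_graph \<Gamma>" "pverts \<Gamma> \<noteq> {}" "minor_of \<Gamma> G" "\<alpha> * real M / 160 \<le> average_degree \<Gamma>"
proof -
  define b where "b = 6 / 25 * \<alpha> * real n / (t * real s)"
  obtain B where B: "\<And>i. i < M \<Longrightarrow> B i \<subseteq> pverts G \<and> connected_in (parcs G) (B i)"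
    and adj: "\<And>i. i < M \<Longrightarrow> \<alpha> / 16 * (real i - b)
      \<le> real (card {j. j < i \<and> (\<exists>x\<in>B i. \<exists>y\<in>B j. (x, y) \<in> parcs G)})"
    and disj: "disjoint_family_on B {..<M}"
    using branch_sets_exist[OF exp t \<alpha> n s k l M(2)] unfolding b_def by blast
  define \<Gamma> where "\<Gamma> = \<lparr>pverts = {..<M},
    parcs = {(i, j). i < M \<and> j < M \<and> i \<noteq> j \<and> (\<exists>x\<in>B i. \<exists>y\<in>B j. (x, y) \<in> parcs G)}\<rparr>"
  note \<Gamma> = minor_of_branch_sets[OF B disj, folded \<Gamma>_def]
  interpret \<Gamma>: pair_graph \<Gamma> by (rule \<Gamma>(1))
  have s0: "0 < real s" using s(2) by simp
  have "b \<le> 6 / 25 * (real M + 1)"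
  proof -
    have "\<alpha> * real n / 10 / (real s) \<le> real M + 1" using M(3) s0 by (simp add: field_simps)
    moreover have "\<alpha> * real n / (t * real s) \<le> \<alpha> * real n / (10 * real s)"
      using t \<alpha> s0 by (intro divide_left_mono) auto
    ultimately show ?thesis by (simp add: b_def)
  qed
  \<comment> \<open>This is where \<open>M\<close> must be at least 5: for M = 5 it reads 1.44 \<le>
    1.5.\<close>
  moreover have "6 / 25 * (real M + 1) \<le> (real M - 1) / 2 - real M / 10"
    using M(1) by (simp add: field_simps)
  ultimately have "real M / 10 \<le> (real M - 1) / 2 - b" by linarith
  then have "\<alpha> / 16 * (real M * (real M / 10)) \<le> \<alpha> / 16 * (real M * ((real M - 1) / 2 - b))"
    using \<alpha> by (intro mult_left_mono) auto
  also have "\<dots> = (\<Sum>i<M. \<alpha> / 16 * (real i - b))"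
  proof -
    have "(\<Sum>i<M. real i - b) = real M * ((real M - 1) / 2 - b)"
      by (induction M) (auto simp: field_simps)
    then show ?thesis by (simp only: sum_distrib_left[symmetric])
  qed
  also have "\<dots> \<le> (\<Sum>i<M. real (card {j. j < i \<and> (\<exists>x\<in>B i. \<exists>y\<in>B j. (x, y) \<in> parcs G)}))"
    using adj by (intro sum_mono) auto
  also have "\<dots> \<le> real (card (parcs \<Gamma>))" using \<Gamma>(3) by (simp only: of_nat_sum[symmetric] of_nat_le_iff)
  finally have "\<alpha> * real M / 160 * real M \<le> real (card (parcs \<Gamma>))" by simp
  then have "\<alpha> * real M / 160 \<le> average_degree \<Gamma>"
    using M(1) unfolding \<Gamma>.average_degree_eq
    by (subst pos_le_divide_eq) (auto simp: \<Gamma>_def)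
  moreover have "pverts \<Gamma> \<noteq> {}" using M(1) by (simp add: \<Gamma>_def lessThan_empty_iff)
  ultimately show ?thesis using that \<Gamma> by blast
qed

end

section \<open>Numerical choice of the parameters\<close>

lemma parameters_exist:
  fixes t \<alpha> :: real and n :: nat
  assumes t: "10 \<le> t" and \<alpha>: "0 < \<alpha>" "\<alpha> < 1" and n: "t \<le> real n"
    and L: "L = ln (real n) / ln t" "6400 * L * t \<le> \<alpha>\<^sup>2 * real n"
  obtains s k l M :: nat where
    "2 * t \<le> \<alpha> * real n" "real s \<le> \<alpha> * real n / (2 * t)" "1 + 2 * Suc k * l \<le> s"
    "real n \<le> (t / 2) ^ k" "2 * real n / (t * real s) \<le> real l"
    "5 \<le> M" "real M * real s \<le> \<alpha> * real n / 10" "\<alpha> * real n / 10 \<le> (real M + 1) * real s"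
    "\<alpha> * sqrt (real n * t / L) / 160 \<le> real M"
proof -
  have n0: "0 < real n" using t n by linarith
  have lnt: "0 < ln t" using t by simp
  have L1: "1 \<le> L" using t n lnt by (simp add: L(1))
  \<comment> \<open>A branch set must hold about n / (t s) paths of length of order
    \<open>L\<close>, so s^2 has to be of order L n / t; \<open>y\<close> is this balance
    point.\<close>
  define y where "y = sqrt (L * real n / t)"
  have y2: "y\<^sup>2 = L * real n / t" using L1 t by (simp add: y_def)
  have y1: "1 \<le> y"
  proof -
    have "1 * 1 \<le> L * (real n / t)" using L1 n t by (intro mult_mono) auto
    then show ?thesis unfolding y_def by simp
  qed
  have y80: "80 * y \<le> \<alpha> * real n / t"
  proof (rule power2_le_imp_le)
    have "(80 * y)\<^sup>2 = 6400 * (L * real n / t)" by (simp add: power_mult_distrib y2)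
    also have "\<dots> = 6400 * L * t * (real n / t\<^sup>2)" using t by (simp add: power2_eq_square)
    also have "\<dots> \<le> \<alpha>\<^sup>2 * real n * (real n / t\<^sup>2)" using L(2) by (intro mult_right_mono) auto
    also have "\<dots> = (\<alpha> * real n / t)\<^sup>2" by (simp add: power2_eq_square)
    finally show "(80 * y)\<^sup>2 \<le> (\<alpha> * real n / t)\<^sup>2" .
  qed (use \<alpha> t in auto)
  \<comment> \<open>The space needed in \<open>kl\<close> is at most 48 y^2 / s, and 48 / 7 \<le> 7
    explains the factor 7. The upper bound 8 y together with \<open>y80\<close> gives 10 s \<le>
    \<alpha> n / t.\<close>
  define s where "s = nat \<lceil>7 * y\<rceil>"
  have s: "7 * y \<le> real s" "real s \<le> 8 * y" using y1 unfolding s_def by linarith+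
  have s0: "0 < real s" using s y1 by linarith
  have ts: "10 * (t * real s) \<le> \<alpha> * real n"
  proof -
    have "10 * real s \<le> \<alpha> * real n / t" using s y80 by linarith
    then show ?thesis using t by (simp add: field_simps)
  qed
  have an: "\<alpha> * real n \<le> real n" using \<alpha> n0 by simp
  \<comment> \<open>As t \<le> (t/2)^2, doubling the exponent \<open>L\<close> compensates for the
    halved expansion: (t/2)^(2 L) \<ge> t^L = n.\<close>
  define k where "k = nat \<lceil>2 * L\<rceil>"
  have k: "2 * L \<le> real k" "real (Suc k) \<le> 4 * L" using L1 unfolding k_def by linarith+
  have nk: "real n \<le> (t / 2) ^ k"
  proof -
    have "t \<le> (t / 2)\<^sup>2" using t mult_right_mono[of 10 t t] by (simp add: power2_eq_square)
    then have "ln t \<le> ln ((t / 2)\<^sup>2)" using t by simp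
    also have "\<dots> = 2 * ln (t / 2)" using t by (simp add: ln_realpow)
    finally have t2: "ln t \<le> 2 * ln (t / 2)" .
    have "ln (real n) = L * ln t" using lnt by (simp add: L(1))
    also have "\<dots> \<le> L * (2 * ln (t / 2))" using t2 L1 by (intro mult_left_mono) auto
    also have "\<dots> \<le> real k * ln (t / 2)" using mult_right_mono[OF k(1), of "ln (t / 2)"] t by simp
    also have "\<dots> = ln ((t / 2) ^ k)" using t by (simp add: ln_realpow)
    finally show ?thesis using n0 t by (subst (asm) ln_le_cancel_iff) auto
  qed
  define x where "x = 2 * real n / (t * real s)"
  define l where "l = nat \<lceil>x\<rceil>"
  have x1: "1 \<le> x"
  proof -
    have "t * real s \<le> 2 * real n" using ts an n0 by linarith
    then show ?thesis using t s0 by (simp add: x_def)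
  qed
  have l: "x \<le> real l" "real l \<le> 2 * x" "1 \<le> l" using x1 unfolding l_def by linarith+
  have kl: "1 + 2 * Suc k * l \<le> s"
  proof -
    have "1 * 1 \<le> real (Suc k) * real l" using l(3) by (intro mult_mono) auto
    moreover have "real (1 + 2 * Suc k * l) = 1 + 2 * (real (Suc k) * real l)"
      by (simp add: algebra_simps)
    ultimately have "real (1 + 2 * Suc k * l) \<le> 3 * (real (Suc k) * real l)" by linarith
    also have "\<dots> \<le> 3 * (4 * L * (2 * x))"
      using k(2) l(2) L1 by (intro mult_left_mono mult_mono) auto
    also have "\<dots> = 48 * y\<^sup>2 / real s" unfolding y2 x_def by simp
    also have "\<dots> \<le> 48 * y\<^sup>2 / (7 * y)" using s(1) y1 by (intro divide_left_mono) auto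
    also have "\<dots> \<le> 7 * y" using y1 by (simp add: power2_eq_square)
    also have "\<dots> \<le> real s" by (rule s(1))
    finally show ?thesis by (simp only: of_nat_le_iff)
  qed
  \<comment> \<open>As many sets of size \<open>s\<close> as fit into \<alpha> n / 10 vertices; z
    \<ge> 10 makes the loss from rounding harmless.\<close>
  define z where "z = \<alpha> * real n / (10 * real s)"
  define M where "M = nat \<lfloor>z\<rfloor>"
  have "10 * (10 * real s) \<le> \<alpha> * real n" using ts mult_right_mono[OF t, of "real s"] by simp
  then have "10 \<le> z" using s0 by (simp add: z_def pos_le_divide_eq)
  then have M: "5 \<le> M" "real M \<le> z" "z \<le> real M + 1" "z / 2 \<le> real M"
    unfolding M_def by linarith+
  have zs: "z * real s = \<alpha> * real n / 10" using s0 by (simp add: z_def)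
  show ?thesis
  proof (rule that[OF _ _ kl nk _ M(1)])
    have "t * 1 \<le> t * real s" using s y1 t by (intro mult_left_mono) auto
    then show "2 * t \<le> \<alpha> * real n" using ts t by linarith
    have "0 \<le> t * real s" using t by simp
    then have "2 * (t * real s) \<le> \<alpha> * real n" using ts by linarith
    then show "real s \<le> \<alpha> * real n / (2 * t)" using t by (simp add: field_simps)
    show "2 * real n / (t * real s) \<le> real l" using l(1) by (simp add: x_def)
    show "real M * real s \<le> \<alpha> * real n / 10" "\<alpha> * real n / 10 \<le> (real M + 1) * real s"
      using M s0 unfolding zs[symmetric] by auto
    have "y * sqrt (real n * t / L) = sqrt ((real n)\<^sup>2)"
      unfolding y_def real_sqrt_mult[symmetric] using L1 t by (simp add: power2_eq_square)
    then have "sqrt (real n * t / L) = real n / y" using y1 by (simp add: field_simps)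
    then have "\<alpha> * sqrt (real n * t / L) / 160 = \<alpha> * real n / (160 * y)" by simp
    also have "\<dots> \<le> \<alpha> * real n / (20 * real s)"
      using s s0 \<alpha> y1 by (intro divide_left_mono) auto
    also have "\<dots> = z / 2" by (simp add: z_def)
    also have "\<dots> \<le> real M" by (rule M(4))
    finally show "\<alpha> * sqrt (real n * t / L) / 160 \<le> real M" .
  qed
qed

text \<open>The assumption \<alpha> n / t \<ge> 1 rules out a degenerate case: below 1, expansion
  tests only the empty set, and edgeless graphs would satisfy it.\<close>

theorem theorem4p1:
  shows "\<exists>c::real. c > 0 \<and>
    (\<forall>(\<alpha>::real) (t::real) (n::nat) (G :: nat pair_pre_digraph).
       0 < \<alpha> \<and> \<alpha> < 1 \<and> t \<ge> 10 \<and>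
       pair_graph G \<and> card (pverts G) = n \<and>
       \<alpha> * real n / t \<ge> 1 \<and>
       expanding t \<alpha> G \<longrightarrow>
       (\<exists>\<Gamma> :: nat pair_pre_digraph.
          pair_graph \<Gamma> \<and> pverts \<Gamma> \<noteq> {} \<and> minor_of \<Gamma> G \<and>
          average_degree \<Gamma> \<ge> c * \<alpha> ^ 3 * (sqrt (real n * t * ln t) / sqrt (ln (real n)))))"
proof (intro exI[of _ "1 / 25600 :: real"] conjI allI impI)
  fix \<alpha> t :: real and n :: nat and G :: "nat pair_pre_digraph"
  assume asm: "0 < \<alpha> \<and> \<alpha> < 1 \<and> t \<ge> 10 \<and> pair_graph G \<and> card (pverts G) = n \<and>
    \<alpha> * real n / t \<ge> 1 \<and> expanding t \<alpha> G"
  then have \<alpha>: "0 < \<alpha>" "\<alpha> < 1" and t: "10 \<le> t" and n: "n = card (pverts G)"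
    and an: "1 \<le> \<alpha> * real n / t" and exp: "expanding t \<alpha> G" by auto
  interpret pair_graph G using asm by simp
  have "t \<le> \<alpha> * real n" using an t by (simp add: field_simps)
  also have "\<dots> \<le> real n" using \<alpha> by (simp add: mult_left_le_one_le)
  finally have tn: "t \<le> real n" .
  define L where "L = ln (real n) / ln t"
  have L1: "1 \<le> L" using t tn by (simp add: L_def)
  define h where "h = sqrt (real n * t / L)"
  have h: "sqrt (real n * t * ln t) / sqrt (ln (real n)) = h"
    unfolding h_def L_def real_sqrt_divide[symmetric] by simp
  have h0: "0 \<le> h" using t L1 by (simp add: h_def)
  show "\<exists>\<Gamma> :: nat pair_pre_digraph. pair_graph \<Gamma> \<and> pverts \<Gamma> \<noteq> {} \<and> minor_of \<Gamma> G \<and>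
    average_degree \<Gamma> \<ge> 1 / 25600 * \<alpha> ^ 3 * (sqrt (real n * t * ln t) / sqrt (ln (real n)))"
    unfolding h
  proof (cases "6400 * L * t \<le> \<alpha>\<^sup>2 * real n")
    case True
    obtain s k l M :: nat where p: "2 * t \<le> \<alpha> * real n" "real s \<le> \<alpha> * real n / (2 * t)"
      "1 + 2 * Suc k * l \<le> s" "real n \<le> (t / 2) ^ k" "2 * real n / (t * real s) \<le> real l"
      "5 \<le> M" "real M * real s \<le> \<alpha> * real n / 10" "\<alpha> * real n / 10 \<le> (real M + 1) * real s"
      and M: "\<alpha> * h / 160 \<le> real M"
      using parameters_exist[OF t \<alpha> tn L_def True] unfolding h_def by metis
    obtain \<Gamma> :: "nat pair_pre_digraph" where \<Gamma>: "pair_graph \<Gamma>" "pverts \<Gamma> \<noteq> {}" "minor_of \<Gamma> G"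
      "\<alpha> * real M / 160 \<le> average_degree \<Gamma>"
      using expanding_minor_of_parameters[OF exp t \<alpha> n p] by metis
    have "1 / 25600 * \<alpha> ^ 3 * h \<le> 1 / 25600 * \<alpha> ^ 2 * h"
      using \<alpha> h0 by (intro mult_right_mono mult_left_mono power_decreasing) auto
    \<comment> \<open>25600 = 160^2: one factor comes from the average degree in terms of
      \<open>M\<close>, the other from \<open>M\<close> in terms of \<open>h\<close>.\<close>
    also have "\<dots> = \<alpha> / 160 * (\<alpha> * h / 160)" by (simp add: power2_eq_square)
    also have "\<dots> \<le> \<alpha> / 160 * real M" using M \<alpha> by (intro mult_left_mono) auto
    also have "\<dots> \<le> average_degree \<Gamma>" using \<Gamma>(4) by simp
    finally show "\<exists>\<Gamma> :: nat pair_pre_digraph. pair_graph \<Gamma> \<and> pverts \<Gamma> \<noteq> {} \<and> minor_of \<Gamma> G \<and>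
      1 / 25600 * \<alpha> ^ 3 * h \<le> average_degree \<Gamma>" using \<Gamma> by blast
  next
    case False
    \<comment> \<open>With h^2 = n t / L, the failed case condition, multiplied by t / L, is the
      square of this inequality.\<close>
    have "\<alpha> * h \<le> 80 * t"
    proof (rule power2_le_imp_le)
      have "(\<alpha> * h)\<^sup>2 = \<alpha>\<^sup>2 * real n * (t / L)"
        using t L1 by (simp add: h_def power_mult_distrib)
      also have "\<dots> \<le> 6400 * L * t * (t / L)"
        using False t L1 by (intro mult_right_mono) auto
      also have "\<dots> = (80 * t)\<^sup>2" using L1 by (simp add: power2_eq_square)
      finally show "(\<alpha> * h)\<^sup>2 \<le> (80 * t)\<^sup>2" .
    qed (use t in simp)
    then have "\<alpha>\<^sup>2 * (\<alpha> * h) \<le> 1 * (80 * t)"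
      using mult_mono[of "\<alpha>\<^sup>2" 1 "\<alpha> * h" "80 * t"] \<alpha> h0 by (simp add: power_le_one)
    then have "1 / 25600 * \<alpha> ^ 3 * h \<le> t" using t by (simp add: power3_eq_cube power2_eq_square)
    moreover have "pverts G \<noteq> {}" using t tn n by auto
    moreover have "t \<le> average_degree G"
      using exp an \<open>pverts G \<noteq> {}\<close> unfolding n by (rule expanding_average_degree_ge)
    ultimately show "\<exists>\<Gamma> :: nat pair_pre_digraph. pair_graph \<Gamma> \<and> pverts \<Gamma> \<noteq> {} \<and> minor_of \<Gamma> G \<and>
      1 / 25600 * \<alpha> ^ 3 * h \<le> average_degree \<Gamma>"
      using minor_of_refl pair_graph by (intro exI[of _ G]) auto
  qed
qed simp

end
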